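(* Let $\mathcal{S}$ be a (nondegenerate) $3$-dimensional simplex such that at least one of the heights of $\mathcal{S}$ is greater than the circumradius of one of its four faces. Then there exists an integer $n_0=n_{0}(\mathcal{S})$, depending only on $\mathcal{S}$, such that for every positive integer $r$ and every $n\ge n_{0}(\mathcal{S})$, $\mathbb{E}^{n} \overset{r}{\rightarrow} (\mathcal{S}; \mathcal{S})_{\mathrm{GR}}$; that is, every coloring $\chi:\mathbb{E}^n\to\{1,\dots,r\}$ contains a monochromatic congruent copy of $\mathcal{S}$ or a rainbow congruent copy of $\mathcal{S}$.
   Context: $\mathbb{E}^n$ denotes $n$-dimensional Euclidean space. A $3$-dimensional simplex (tetrahedron) is identified with its set of four affinely independent vertices. Its four heights are the distances from each vertex to the plane spanned by the other three vertices; its four faces are the triangles formed by triples of vertices, and the circumradius of a face is the radius of the circle in its plane passing through its three vertices. A congruent copy of a finite point set is its image under a distance-preserving map. A copy is monochromatic if all its points have the same color, and rainbow if its points have pairwise distinct colors. For configurations $\mathcal{K}_1,\mathcal{K}_2$, the notation $\mathbb{E}^n \overset{r}{\rightarrow} (\mathcal{K}_1;\mathcal{K}_2)_{\mathrm{GR}}$ means that every coloring $\chi:\mathbb{E}^n\to[r]$ yields a monochromatic congruent copy of $\mathcal{K}_1$ or a rainbow congruent copy of $\mathcal{K}_2$. *)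

theory Defs
  imports "HOL-Analysis.Analysis"
begin

text \<open>
  The dimension \<open>n\<close> is quantified inside the formulas below, so it cannot be a type index. The
  points of \<open>n\<close>-dimensional Euclidean space are therefore those of the library's
  \<^const>\<open>Euclidean_space\<close>, i.e. sequences \<open>x :: nat \<Rightarrow> real\<close> with \<open>x i = 0\<close> for \<open>i \<ge> n\<close>. As that
  is only a topological space, the metric is given separately; it is the formula by which the
  library defines \<^const>\<open>dist\<close> on \<open>real ^ 'n\<close>.
\<close>

definition edist :: "nat \<Rightarrow> (nat \<Rightarrow> real) \<Rightarrow> (nat \<Rightarrow> real) \<Rightarrow> real" where
  "edist n x y = L2_set (\<lambda>i. dist (x i) (y i)) {..<n}"

definition congruent_copy :: "nat \<Rightarrow> 'a::metric_space set \<Rightarrow> (nat \<Rightarrow> real) set \<Rightarrow> bool" where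
  "congruent_copy n K T \<longleftrightarrow>
     (\<exists>f. f \<in> K \<rightarrow> topspace (Euclidean_space n) \<and>
          (\<forall>x\<in>K. \<forall>y\<in>K. edist n (f x) (f y) = dist x y) \<and> T = f ` K)"

definition monochromatic :: "('p \<Rightarrow> nat) \<Rightarrow> 'p set \<Rightarrow> bool" where
  "monochromatic col T \<longleftrightarrow> (\<exists>c. \<forall>x\<in>T. col x = c)"

definition rainbow :: "('p \<Rightarrow> nat) \<Rightarrow> 'p set \<Rightarrow> bool" where
  "rainbow col T \<longleftrightarrow> inj_on col T"

definition gallai_ramsey ::
  "nat \<Rightarrow> nat \<Rightarrow> 'a::metric_space set \<Rightarrow> 'b::metric_space set \<Rightarrow> bool" where
  "gallai_ramsey n r K1 K2 \<longleftrightarrow>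
     (\<forall>col \<in> topspace (Euclidean_space n) \<rightarrow> {1..r}.
        (\<exists>T. congruent_copy n K1 T \<and> monochromatic col T) \<or>
        (\<exists>T. congruent_copy n K2 T \<and> rainbow col T))"

text \<open>A tetrahedron is identified with its set of vertices.\<close>

definition tetrahedron :: "'a::euclidean_space set \<Rightarrow> bool" where
  "tetrahedron S \<longleftrightarrow> card S = 4 \<and> \<not> affine_dependent S"

definition face :: "'a set \<Rightarrow> 'a set \<Rightarrow> bool" where
  "face S F \<longleftrightarrow> F \<subseteq> S \<and> card F = 3"

definition height :: "'a::euclidean_space set \<Rightarrow> 'a \<Rightarrow> real" where
  "height S v = infdist v (affine hull (S - {v}))"

text \<open>
  The centre is required to lie in the plane of the triangle \<open>F\<close>; without this, \<open>F\<close> lies on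
  spheres of many radii.
\<close>

definition circumradius :: "'a::euclidean_space set \<Rightarrow> real" where
  "circumradius F = (THE \<rho>. \<exists>c \<in> affine hull F. \<forall>p\<in>F. dist c p = \<rho>)"

text \<open>The description in \<^const>\<open>circumradius\<close> is proper for every nondegenerate triangle.\<close>

lemma circumradius_ex1:
  fixes F :: "'a::euclidean_space set"
  assumes "card F = 3" and ind: "\<not> affine_dependent F"
  shows "\<exists>!\<rho>. \<exists>c \<in> affine hull F. \<forall>p\<in>F. dist c p = \<rho>"
proof -
  obtain a b d where F: "F = {a, b, d}" and ne: "a \<noteq> b" "a \<noteq> d" "b \<noteq> d"
    using assms(1) by (auto simp: card_3_iff)
  define u v where "u = b - a" and "v = d - a"
  have hull: "x \<in> affine hull F \<longleftrightarrow> (\<exists>s t. x = a + s *\<^sub>R u + t *\<^sub>R v)" for x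
  proof
    assume "x \<in> affine hull F"
    then obtain p q r where "p + q + r = 1" "x = p *\<^sub>R a + q *\<^sub>R b + r *\<^sub>R d"
      by (auto simp: F affine_hull_3)
    moreover from this have "p = 1 - q - r" by simp
    ultimately have "x = a + q *\<^sub>R u + r *\<^sub>R v"
      by (simp add: u_def v_def algebra_simps)
    then show "\<exists>s t. x = a + s *\<^sub>R u + t *\<^sub>R v" by blast
  next
    assume "\<exists>s t. x = a + s *\<^sub>R u + t *\<^sub>R v"
    then obtain s t where "x = a + s *\<^sub>R u + t *\<^sub>R v" by blast
    then have "x = (1 - s - t) *\<^sub>R a + s *\<^sub>R b + t *\<^sub>R d"
      by (simp add: u_def v_def algebra_simps)
    moreover have "(1 - s - t) + s + t = 1" by simp
    ultimately show "x \<in> affine hull F"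
      unfolding F affine_hull_3 by blast
  qed
  have indep: "\<not> collinear {a, b, d}"
    using ind ne by (simp add: F collinear_3_eq_affine_dependent)
  define D where "D = (u \<bullet> u) * (v \<bullet> v) - (u \<bullet> v)\<^sup>2"
  have "D \<noteq> 0"
  proof
    assume "D = 0"
    then have "(u \<bullet> v)\<^sup>2 = (norm u * norm v)\<^sup>2"
      by (simp add: D_def power_mult_distrib power2_norm_eq_inner)
    then have "\<bar>u \<bullet> v\<bar> = norm u * norm v"
      by (metis abs_of_nonneg mult_nonneg_nonneg norm_ge_zero power2_eq_iff_nonneg power2_abs abs_ge_zero)
    then have "collinear {0, u, v}"
      by (simp add: norm_cauchy_schwarz_equal)
    then have "collinear {b, a, d}"
      by (subst collinear_3) (simp_all only: NO_MATCH_def u_def v_def)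
    then show False using indep by (simp add: insert_commute)
  qed
  define s t where
    "s = (v \<bullet> v) * (u \<bullet> u - u \<bullet> v) / (2 * D)" and "t = (u \<bullet> u) * (v \<bullet> v - u \<bullet> v) / (2 * D)"
  define w where "w = s *\<^sub>R u + t *\<^sub>R v"
  have eqs: "2 * (w \<bullet> u) = u \<bullet> u" "2 * (w \<bullet> v) = v \<bullet> v"
  proof -
    have e: "2 * D * s = (v \<bullet> v) * (u \<bullet> u - u \<bullet> v)" "2 * D * t = (u \<bullet> u) * (v \<bullet> v - u \<bullet> v)"
      using \<open>D \<noteq> 0\<close> by (simp_all add: s_def t_def)
    have f: "D * (2 * (w \<bullet> u)) = (2 * D * s) * (u \<bullet> u) + (2 * D * t) * (u \<bullet> v)"
      "D * (2 * (w \<bullet> v)) = (2 * D * s) * (u \<bullet> v) + (2 * D * t) * (v \<bullet> v)"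
      by (simp_all add: w_def inner_simps inner_commute algebra_simps)
    have "D * (2 * (w \<bullet> u)) = D * (u \<bullet> u)" "D * (2 * (w \<bullet> v)) = D * (v \<bullet> v)"
      unfolding f unfolding e unfolding D_def by (simp_all add: power2_eq_square algebra_simps)
    then show "2 * (w \<bullet> u) = u \<bullet> u" "2 * (w \<bullet> v) = v \<bullet> v"
      using \<open>D \<noteq> 0\<close> by simp_all
  qed
  have dist_iff: "dist (a + x) (a + y) = dist (a + x) a \<longleftrightarrow> 2 * (x \<bullet> y) = y \<bullet> y" for x y
    by (auto simp: dist_norm norm_eq inner_simps inner_commute)
  have ba: "b = a + u" "d = a + v" by (simp_all add: u_def v_def)
  have "\<forall>p\<in>F. dist (a + w) p = dist (a + w) a"
    using eqs dist_iff[of w u] dist_iff[of w v] by (auto simp: F ba)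
  moreover have "a + w \<in> affine hull F"
    unfolding hull w_def by (metis add.assoc)
  ultimately have ex: "\<exists>c \<in> affine hull F. \<forall>p\<in>F. dist c p = dist (a + w) a" by blast
  moreover have "\<rho> = dist (a + w) a"
    if mem: "c \<in> affine hull F" and c: "\<forall>p\<in>F. dist c p = \<rho>" for \<rho> c
  proof -
    obtain s' t' where st: "c = a + s' *\<^sub>R u + t' *\<^sub>R v" using mem hull by blast
    define x where "x = s' *\<^sub>R u + t' *\<^sub>R v"
    have cx: "c = a + x" by (simp add: st x_def add.assoc)
    have "2 * (x \<bullet> u) = u \<bullet> u" "2 * (x \<bullet> v) = v \<bullet> v"
      using c dist_iff[of x u] dist_iff[of x v] by (auto simp: F ba cx)
    with eqs have o: "(x - w) \<bullet> u = 0" "(x - w) \<bullet> v = 0"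
      by (simp_all add: inner_diff_left)
    have "x - w = (s' - s) *\<^sub>R u + (t' - t) *\<^sub>R v"
      by (simp add: x_def w_def algebra_simps)
    then have "(x - w) \<bullet> (x - w) = (s' - s) * ((x - w) \<bullet> u) + (t' - t) * ((x - w) \<bullet> v)"
      by (metis inner_add_right inner_scaleR_right)
    with o have "x = w" by simp
    then show ?thesis using c by (simp add: F cx)
  qed
  ultimately show ?thesis by (intro ex1I[where a = "dist (a + w) a"]) blast+
qed

end

theory Submission
  imports Defs "HOL-Library.Ramsey"
begin

text \<open>
  Fix \<open>k\<close> real coefficients \<open>a 0, \<dots>, a (k - 1)\<close>. A strictly increasing \<open>u\<close> from \<open>{..<k}\<close> to the
  coordinate axes gives the point whose coordinate on axis \<open>u p\<close> is \<open>a p\<close>; all points obtained in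
  this way form a spread. A colouring of space thus becomes a colouring of \<open>k\<close>-subsets, and the
  distance of two points depends only on which positions of the two index sequences coincide. The
  theorem follows from two facts about spreads.

  The first is combinatorial (\<open>canonical_ramsey_placement\<close>). Let finitely many increasing sequences
  \<open>\<sigma> i\<close> be given, no two of which agree at any position. If there are enough axes, then for
  every colouring the whole pattern can be relabelled by an increasing map so that it becomes
  monochromatic or rainbow. This is the part of the Erdos-Rado canonical Ramsey theorem that is needed
  here. Its point is that the number of axes depends only on the pattern: Ramsey's theorem is
  applied not to the colours but to the equality relation that they induce on the pattern,
  and there are only finitely many such relations. If two of the sequences always receive equal
  colours, then moving single entries back and forth shows that the colouring is constant on all
  sufficiently sparse sequences.

  The second is geometric (\<open>distance_matrix_in_spread_matrices\<close>): the vertices of every simplex can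
  be placed in a spread, in positions \<open>\<sigma> i\<close> as above. The matrices of squared distances so
  realised form a convex cone, since patterns can be scaled and put side by side on disjoint axes.
  Translates of a long triangular wave realise, up to scaling and in the limit, all matrices
  \<open>(x\<^sub>i - x\<^sub>j)\<^sup>2\<close>. Hence a functional \<open>y\<close> separating the cone from the matrix of a simplex would
  make \<open>\<Sum>\<^sub>i\<^sub>j y\<^sub>i\<^sub>j (x\<^sub>i - x\<^sub>j)\<^sup>2\<close> a nonnegative quadratic form in \<open>x\<close> that vanishes on the coordinates
  of the simplex. By affine independence it then vanishes everywhere, and \<open>y = 0\<close>.
\<close>

section \<open>Colourings of increasing sequences\<close>

text \<open>
  The tool for moving one entry of a sequence. The values \<open>u q\<close> prescribed at the positions \<open>\<sigma> q\<close>
  are extended to an increasing map on \<open>{..<M}\<close>. The bound \<open>m q\<close>, which may exceed \<open>u q\<close>, marks the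
  place after which the positions between \<open>\<sigma> q\<close> and \<open>\<sigma> (q + 1)\<close> are filled, in steps of \<open>g\<close>. Two
  sequences with the same \<open>m\<close> therefore get extensions that differ only at the positions \<open>\<sigma> q\<close>
  where the sequences differ. In the definition of \<open>e\<close>, \<open>r n\<close> counts the prescribed positions up to \<open>n\<close>.
\<close>
lemma fill_in_gaps:
  fixes \<sigma> u m :: "nat \<Rightarrow> nat"
  assumes \<sigma>: "strict_mono_on {..<k} \<sigma>" "\<And>q. q < k \<Longrightarrow> \<sigma> q < M"
    and low: "\<And>q. q < k \<Longrightarrow> (if q = 0 then 0 else m (q - 1)) + Suc M * g \<le> u q"
    and high: "\<And>q. q < k \<Longrightarrow> u q \<le> m q"
    and top: "(if k = 0 then 0 else m (k - 1)) + Suc M * g \<le> L"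
    and g: "0 < g" "\<And>q. q < k \<Longrightarrow> g dvd u q" "\<And>q. q < k \<Longrightarrow> g dvd m q"
  defines "r \<equiv> \<lambda>n. card {q. q < k \<and> \<sigma> q \<le> n}"
  defines "base \<equiv> \<lambda>c. if c = 0 then 0 else m (c - 1)"
  defines "e \<equiv> \<lambda>n. if n \<in> \<sigma> ` {..<k} then u (r n - 1) else base (r n) + Suc n * g"
  shows "strict_mono_on {..<M} e" 
    and "\<And>q. q < k \<Longrightarrow> e (\<sigma> q) = u q"
    and "\<And>n. n < M \<Longrightarrow> 0 < e n \<and> e n < L \<and> g dvd e n"
proof -
  have r_le: "r n \<le> k" for n
  proof -
    have "r n \<le> card {..<k}" unfolding r_def by (rule card_mono) auto
    then show ?thesis by simp
  qed
  have r_mono: "r n \<le> r n'" if "n \<le> n'" for n n'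
    unfolding r_def using that by (intro card_mono) auto
  have r_strict: "r n < r n'" if "n < n'" "n' \<in> \<sigma> ` {..<k}" for n n'
  proof -
    from that obtain q where "q < k" "n' = \<sigma> q" by auto
    moreover have "{q. q < k \<and> \<sigma> q \<le> n} \<subseteq> {q. q < k \<and> \<sigma> q \<le> n'}"
      using that(1) by auto
    moreover have "q \<in> {q. q < k \<and> \<sigma> q \<le> n'}" "q \<notin> {q. q < k \<and> \<sigma> q \<le> n}"
      using that(1) calculation(1,2) by auto
    ultimately have "{q. q < k \<and> \<sigma> q \<le> n} \<subset> {q. q < k \<and> \<sigma> q \<le> n'}"
      by blast
    then show ?thesis unfolding r_def by (intro psubset_card_mono) auto
  qed
  have r_\<sigma>: "r (\<sigma> q) = Suc q" if "q < k" for q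
  proof -
    have "{q'. q' < k \<and> \<sigma> q' \<le> \<sigma> q} = {..q}"
      using that \<sigma>(1) by (auto simp: strict_mono_on_leD strict_mono_on_less_eq)
    then show ?thesis by (simp add: r_def)
  qed
  show e_\<sigma>: "e (\<sigma> q) = u q" if "q < k" for q
    using that by (simp add: e_def r_\<sigma>)
  have base_step: "base c + Suc M * g \<le> base (Suc c)" if "c < k" for c
    using low[OF that] high[OF that] by (simp add: base_def)
  have base_less: "base c + Suc M * g \<le> base c'" if "c < c'" "c' \<le> k" for c c'
    using that
  proof (induction c' rule: nat_less_induct)
    case (1 c')
    then obtain b where b: "c' = Suc b" by (cases c') auto
    show ?case
    proof (cases "c = b")
      case True then show ?thesis using base_step b 1 by simp
    next
      case False
      then have "base c + Suc M * g \<le> base b" using 1 b by simp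
      then show ?thesis using base_step[of b] b 1 by simp
    qed
  qed
  have base_mono: "base c \<le> base c'" if "c \<le> c'" "c' \<le> k" for c c'
    using base_less[of c c'] that by (cases "c = c'") auto
  have point: "base (r n - 1) + Suc M * g \<le> e n \<and> e n \<le> base (r n) \<and> r n > 0"
    if "n \<in> \<sigma> ` {..<k}" for n
  proof -
    from that obtain q where "n = \<sigma> q" "q < k" by auto
    then show ?thesis using low[of q] high[of q] by (simp add: e_\<sigma> r_\<sigma> base_def)
  qed
  have fill: "e n = base (r n) + Suc n * g" if "n \<notin> \<sigma> ` {..<k}" for n
    using that by (simp add: e_def)
  have small: "Suc n * g < Suc M * g" if "n < M" for n using that g(1) by simp
  have upper: "e n < base (r n) + Suc M * g" if "n < M" for n
    using point[of n] fill[of n] small[OF that] g(1)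
    by (cases "n \<in> \<sigma> ` {..<k}") (auto intro: le_less_trans)
  show "strict_mono_on {..<M} e"
  proof (rule strict_mono_onI)
    fix n n' assume n: "n \<in> {..<M}" "n' \<in> {..<M}" "n < n'"
    show "e n < e n'"
    proof (cases "n' \<in> \<sigma> ` {..<k}")
      case True
      have "r n \<le> r n' - 1" using r_strict[OF n(3) True] by simp
      then have "base (r n) \<le> base (r n' - 1)"
        using r_le[of n'] by (intro base_mono) auto
      then show ?thesis using upper[of n] point[OF True] n by auto
    next
      case False
      show ?thesis
      proof (cases "r n = r n'")
        case True
        have "Suc n * g < Suc n' * g" using n g(1) by simp
        then show ?thesis using True fill[OF False] fill[of n] point[of n] g(1)
          by (cases "n \<in> \<sigma> ` {..<k}") (auto intro: le_less_trans)
      next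
        case neq: False
        then have "base (r n) + Suc M * g \<le> base (r n')"
          using base_less[of "r n" "r n'"] r_mono[of n n'] r_le[of n'] n by simp
        then show ?thesis using upper[of n] fill[OF False] n by auto
      qed
    qed
  qed
  show "0 < e n \<and> e n < L \<and> g dvd e n" if "n < M" for n
  proof (intro conjI)
    show "0 < e n"
      using point[of n] fill[of n] g(1) by (cases "n \<in> \<sigma> ` {..<k}") (auto intro: less_le_trans)
    have "base (r n) \<le> base k"
      using r_le by (intro base_mono) auto
    moreover have "base k + Suc M * g \<le> L" using top by (simp add: base_def)
    ultimately show "e n < L" using upper[OF that] by linarith
    show "g dvd e n"
    proof (cases "n \<in> \<sigma> ` {..<k}")
      case True then show ?thesis using g(2) e_\<sigma> by auto
    next
      case False
      have "g dvd base (r n)" using g(3) r_le[of n] by (auto simp: base_def)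
      then show ?thesis using fill[OF False] by simp
    qed
  qed
qed

lemma multiples_apart:
  fixes x y :: nat
  assumes "d dvd x" "d dvd y" "x < y" shows "x + d \<le> y"
proof -
  obtain a b where "x = d * a" "y = d * b" using assms by (auto elim!: dvdE)
  then have "d * Suc a \<le> d * b" using assms(3) by (intro mult_le_mono2) simp
  then show ?thesis using \<open>x = d * a\<close> \<open>y = d * b\<close> by simp
qed

text \<open>
  Extend both \<open>u\<close> and \<open>u'\<close> along \<open>\<sigma>\<close> to maps \<open>e\<close> and \<open>e'\<close> that differ only at \<open>\<sigma> p\<close>. If \<open>\<sigma> p\<close> is
  not a value of \<open>\<tau>\<close>, then \<open>e \<circ> \<tau> = e' \<circ> \<tau>\<close> and the invariance of \<open>F\<close> gives the claim. If \<open>\<sigma> p = \<tau> q\<close>,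
  then \<open>e \<circ> \<tau>\<close> and \<open>e' \<circ> \<tau>\<close> again differ in a single entry, the one at \<open>q\<close>; from \<open>\<sigma> p < \<tau> p\<close> it follows
  that \<open>q < p\<close> and \<open>\<sigma> q < \<tau> q\<close>, so induction applies. Every round of the induction uses up one factor
  \<open>Suc M\<close> of the spacing between the entries.
\<close>
lemma move_one_coordinate:
  fixes F :: "(nat \<Rightarrow> nat) \<Rightarrow> 'c" and \<sigma> \<tau> u u' :: "nat \<Rightarrow> nat"
  assumes cong: "\<And>u w. (\<And>p. p < k \<Longrightarrow> u p = w p) \<Longrightarrow> F u = F w"
    and \<sigma>: "strict_mono_on {..<k} \<sigma>" "\<And>q. q < k \<Longrightarrow> \<sigma> q < M"
    and \<tau>: "strict_mono_on {..<k} \<tau>" "\<And>q. q < k \<Longrightarrow> \<tau> q < M"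
    and inv: "\<And>e. strict_mono_on {..<M} e \<Longrightarrow> (\<And>n. n < M \<Longrightarrow> e n < L) \<Longrightarrow> F (e \<circ> \<sigma>) = F (e \<circ> \<tau>)"
    and p: "p < k" "\<sigma> p < \<tau> p"
    and u: "strict_mono_on {..<k} u" "\<And>q. q < k \<Longrightarrow> 0 < u q \<and> u q < L \<and> Suc M ^ Suc p dvd u q"
    and u': "strict_mono_on {..<k} u'" "\<And>q. q < k \<Longrightarrow> 0 < u' q \<and> u' q < L \<and> Suc M ^ Suc p dvd u' q"
    and L: "Suc M ^ Suc p dvd L"
    and eq: "\<And>q. q < k \<Longrightarrow> q \<noteq> p \<Longrightarrow> u q = u' q"
  shows "F u = F u'"
  using p u u' L eq
proof (induction p arbitrary: u u' rule: less_induct)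
  case (less p)
  note p = less.prems(1,2) and u = less.prems(3,4) and u' = less.prems(5,6)
    and L = less.prems(7) and eq = less.prems(8)
  define g where "g = Suc M ^ p"
  \<comment> \<open>With this bound the gaps are filled clear of both \<open>u q\<close> and \<open>u' q\<close>.\<close>
  define m where "m q = max (u q) (u' q)" for q
  have g: "0 < g" and G: "Suc M ^ Suc p = Suc M * g" by (simp_all add: g_def)
  have dv: "Suc M * g dvd u q" "Suc M * g dvd u' q" "Suc M * g dvd m q" "g dvd u q" "g dvd u' q" "g dvd m q" if "q < k" for q
    using u(2)[OF that] u'(2)[OF that] unfolding G m_def max_def by (auto dest: dvd_mult_right)
  have low: "(if q = 0 then 0 else m (q - 1)) + Suc M * g \<le> u q \<and>
             (if q = 0 then 0 else m (q - 1)) + Suc M * g \<le> u' q" if q: "q < k" for q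
  proof (cases q)
    case 0
    then show ?thesis using dv[OF q] u(2)[OF q] u'(2)[OF q] by (simp add: dvd_imp_le del: mult_Suc)
  next
    case (Suc q')
    have "u q' < u q" "u' q' < u' q" 
      using u(1) u'(1) q Suc by (auto simp: strict_mono_on_def)
    moreover have "u q' = u' q' \<or> u q = u' q" using eq Suc q
      by (metis Suc_lessD n_not_Suc_n)
    ultimately have "m q' < u q \<and> m q' < u' q"
      unfolding m_def by (auto simp: max_def)
    then show ?thesis using multiples_apart dv(1,2)[OF q] dv(3)[of q'] Suc q by (simp del: mult_Suc)
  qed
  have high: "u q \<le> m q" "u' q \<le> m q" for q by (simp_all add: m_def)
  have top: "(if k = 0 then 0 else m (k - 1)) + Suc M * g \<le> L"
    using multiples_apart[OF dv(3)[of "k - 1"], of L] L p(1) u(2)[of "k - 1"] u'(2)[of "k - 1"]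
    unfolding G by (simp add: m_def)
  define r where "r n = card {q. q < k \<and> \<sigma> q \<le> n}" for n
  define e where "e v n = (if n \<in> \<sigma> ` {..<k} then v (r n - 1) 
    else (if r n = 0 then 0 else m (r n - 1)) + Suc n * g)" for v n
  have e: "strict_mono_on {..<M} (e v)" "\<And>q. q < k \<Longrightarrow> e v (\<sigma> q) = v q"
    "\<And>n. n < M \<Longrightarrow> 0 < e v n \<and> e v n < L \<and> g dvd e v n" if v: "v = u \<or> v = u'" for v
  proof -
    have "(if q = 0 then 0 else m (q - 1)) + Suc M * g \<le> v q" "v q \<le> m q" "g dvd v q" if "q < k" for q
      using v low[OF that] high dv[OF that] by auto
    note E = fill_in_gaps[of k \<sigma> M m g v L, folded r_def, folded e_def, OF \<sigma> this(1,2) top g this(3) dv(6)]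
    show "strict_mono_on {..<M} (e v)" by (rule E(1))
    show "e v (\<sigma> q) = v q" if "q < k" for q using E(2) that by simp
    show "0 < e v n \<and> e v n < L \<and> g dvd e v n" if "n < M" for n using E(3)[of n] that by blast
  qed
  have F: "F v = F (e v \<circ> \<tau>)" if "v = u \<or> v = u'" for v
  proof -
    have "F v = F (e v \<circ> \<sigma>)" by (rule cong) (simp add: e(2)[OF that])
    also have "\<dots> = F (e v \<circ> \<tau>)" by (rule inv) (use e(1,3)[OF that] in blast)+
    finally show ?thesis .
  qed
  have diff: "e u n = e u' n" if "n \<noteq> \<sigma> p" for n
  proof (cases "n \<in> \<sigma> ` {..<k}")
    case True
    then obtain q where "n = \<sigma> q" "q < k" by auto
    then show ?thesis using that e(2)[of u q] e(2)[of u' q] eq[of q] by auto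
  qed (simp add: e_def)
  have "F (e u \<circ> \<tau>) = F (e u' \<circ> \<tau>)"
  proof (cases "\<sigma> p \<in> \<tau> ` {..<k}")
    case False
    then have "\<tau> q \<noteq> \<sigma> p" if "q < k" for q using that by (metis imageI lessThan_iff)
    then show ?thesis by (intro cong) (simp add: diff)
  next
    case True
    then obtain q where q: "q < k" "\<sigma> p = \<tau> q" by auto
    have "q < p" using p q \<tau>(1) by (simp add: strict_mono_on_less)
    have "\<sigma> q < \<tau> q" using strict_mono_onD[OF \<sigma>(1) _ _ \<open>q < p\<close>] q p by simp
    have dvd: "Suc M ^ Suc q dvd g" unfolding g_def using \<open>q < p\<close> by (intro le_imp_power_dvd) simp
    show ?thesis
    proof (rule less.IH[OF \<open>q < p\<close> q(1) \<open>\<sigma> q < \<tau> q\<close>])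
      show "strict_mono_on {..<k} (e u \<circ> \<tau>)" "strict_mono_on {..<k} (e u' \<circ> \<tau>)"
        using e(1)[of u] e(1)[of u'] \<tau> by (auto simp: strict_mono_on_def)
      show "0 < (e u \<circ> \<tau>) q' \<and> (e u \<circ> \<tau>) q' < L \<and> Suc M ^ Suc q dvd (e u \<circ> \<tau>) q'"
        "0 < (e u' \<circ> \<tau>) q' \<and> (e u' \<circ> \<tau>) q' < L \<and> Suc M ^ Suc q dvd (e u' \<circ> \<tau>) q'" if "q' < k" for q'
        using e(3)[of u, OF _ \<tau>(2)[OF that]] e(3)[of u', OF _ \<tau>(2)[OF that]] dvd_trans[OF dvd]
        by (auto simp del: power_Suc)
      show "Suc M ^ Suc q dvd L" using dvd L G by (metis dvd_mult dvd_trans)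
      show "(e u \<circ> \<tau>) q' = (e u' \<circ> \<tau>) q'" if "q' < k" "q' \<noteq> q" for q'
      proof -
        have "\<tau> q' \<noteq> \<tau> q" using that q(1) strict_mono_on_imp_inj_on[OF \<tau>(1)] by (auto simp: inj_on_def)
        then show ?thesis using diff[of "\<tau> q'"] q(2) by simp
      qed
    qed
  qed
  then show ?case using F by auto
qed

text \<open>
  Any two sparse sequences are joined by moves of one entry at a time: both can be carried to the
  top of the range, the last entry first. A position with \<open>\<tau> p < \<sigma> p\<close> is handled by exchanging the
  roles of \<open>\<sigma>\<close> and \<open>\<tau>\<close>.
\<close>
lemma shift_invariance_imp_constant:
  fixes F :: "(nat \<Rightarrow> nat) \<Rightarrow> 'c" and \<sigma> \<tau> u w :: "nat \<Rightarrow> nat"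
  assumes cong: "\<And>u w. (\<And>p. p < k \<Longrightarrow> u p = w p) \<Longrightarrow> F u = F w"
    and \<sigma>: "strict_mono_on {..<k} \<sigma>" "\<And>q. q < k \<Longrightarrow> \<sigma> q < M"
    and \<tau>: "strict_mono_on {..<k} \<tau>" "\<And>q. q < k \<Longrightarrow> \<tau> q < M"
    and ne: "\<And>q. q < k \<Longrightarrow> \<sigma> q \<noteq> \<tau> q"
    and inv: "\<And>e. strict_mono_on {..<M} e \<Longrightarrow> (\<And>n. n < M \<Longrightarrow> e n < (T + Suc k) * Suc M ^ k)
                \<Longrightarrow> F (e \<circ> \<sigma>) = F (e \<circ> \<tau>)"
    and u: "strict_mono_on {..<k} u" "\<And>q. q < k \<Longrightarrow> 0 < u q \<and> u q \<le> T"
    and w: "strict_mono_on {..<k} w" "\<And>q. q < k \<Longrightarrow> 0 < w q \<and> w q \<le> T"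
  shows "F (\<lambda>p. u p * Suc M ^ k) = F (\<lambda>p. w p * Suc M ^ k)"
proof -
  define G where "G = Suc M ^ k"
  have G: "0 < G" by (simp add: G_def)
  have move: "F v = F v'"
    if "p < k" and v: "strict_mono_on {..<k} v" "\<And>q. q < k \<Longrightarrow> 0 < v q \<and> v q < (T + Suc k) * G \<and> G dvd v q"
      and v': "strict_mono_on {..<k} v'" "\<And>q. q < k \<Longrightarrow> 0 < v' q \<and> v' q < (T + Suc k) * G \<and> G dvd v' q"
      and eq: "\<And>q. q < k \<Longrightarrow> q \<noteq> p \<Longrightarrow> v q = v' q" for p v v'
  proof -
    have d: "Suc M ^ Suc p dvd G" unfolding G_def using \<open>p < k\<close> by (intro le_imp_power_dvd) simp
    have d': "0 < v q \<and> v q < (T + Suc k) * G \<and> Suc M ^ Suc p dvd v q" 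
             "0 < v' q \<and> v' q < (T + Suc k) * G \<and> Suc M ^ Suc p dvd v' q" if "q < k" for q
      using v(2)[OF that] v'(2)[OF that] d dvd_trans by blast+
    have dL: "Suc M ^ Suc p dvd (T + Suc k) * G" using d by (rule dvd_mult)
    note inv' = inv[folded G_def]
    consider "\<sigma> p < \<tau> p" | "\<tau> p < \<sigma> p" using ne[OF \<open>p < k\<close>] by linarith
    then show ?thesis
    proof cases
      case 1
      show ?thesis
        by (rule move_one_coordinate[OF cong \<sigma> \<tau> inv' \<open>p < k\<close> 1 v(1) d'(1) v'(1) d'(2) dL eq])
    next
      case 2
      show ?thesis
        by (rule move_one_coordinate[OF cong \<tau> \<sigma> inv'[symmetric] \<open>p < k\<close> 2 v(1) d'(1) v'(1) d'(2) dL eq])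
    qed
  qed
  have to_top: "F (\<lambda>p. u p * G) = F (\<lambda>p. Suc (T + p) * G)"
    if u: "strict_mono_on {..<k} u" "\<And>q. q < k \<Longrightarrow> 0 < u q \<and> u q \<le> T" for u
  proof -
    \<comment> \<open>The entries from \<open>j\<close> on have been carried above the bound \<open>T\<close>.\<close>
    define mix where "mix j p = (if p < j then u p else Suc (T + p)) * G" for j p
    have mono: "strict_mono_on {..<k} (mix j)" if "j \<le> k" for j
    proof (rule strict_mono_onI)
      fix p q assume "p \<in> {..<k}" "q \<in> {..<k}" "p < q"
      moreover have "u p < u q" using calculation u(1) by (simp add: strict_mono_on_def)
      ultimately show "mix j p < mix j q" using u(2)[of p] G by (auto simp: mix_def)
    qed
    have bd: "0 < mix j q \<and> mix j q < (T + Suc k) * G \<and> G dvd mix j q" if "q < k" for j q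
      using u(2)[OF that] that G by (auto simp: mix_def simp del: mult_Suc)
    have "F (mix j) = F (mix 0)" if "j \<le> k" for j
      using that
    proof (induction j)
      case (Suc j)
      have "F (mix (Suc j)) = F (mix j)"
        by (rule move[of j]) (use Suc.prems mono bd in \<open>auto simp: mix_def\<close>)
      then show ?case using Suc by simp
    qed simp
    from this[of k] have "F (mix k) = F (mix 0)" by simp
    moreover have "F (mix k) = F (\<lambda>p. u p * G)" by (rule cong) (simp add: mix_def)
    moreover have "F (mix 0) = F (\<lambda>p. Suc (T + p) * G)" by (rule cong) (simp add: mix_def)
    ultimately show ?thesis by simp
  qed
  show ?thesis using to_top[OF u] to_top[OF w] unfolding G_def by simp
qed

lemma strict_mono_on_image_unique:
  fixes g h :: "nat \<Rightarrow> nat"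
  assumes "strict_mono_on {..<M} g" "strict_mono_on {..<M} h" "g ` {..<M} = h ` {..<M}" "n < M"
  shows "g n = h n"
proof -
  have "sorted_wrt (<) (map f [0..<M])" if "strict_mono_on {..<M} f" for f :: "nat \<Rightarrow> nat"
    using that by (auto simp: sorted_wrt_iff_nth_less strict_mono_on_def)
  then have "map g [0..<M] = map h [0..<M]"
    using assms by (intro strict_sorted_equal) (auto simp: atLeast0LessThan)
  then show ?thesis using assms(4) by (simp add: map_eq_conv)
qed

text \<open>
  Ramsey's theorem is applied to the \<open>M\<close>-subsets of the axes, each coloured by the set of pairs
  \<open>(i, j)\<close> for which \<open>F\<close> agrees on the copies of \<open>\<sigma> i\<close> and \<open>\<sigma> j\<close> inside it. On a homogeneous set
  either no pair \<open>i \<noteq> j\<close> ever agrees, so every copy of the pattern is rainbow, or one pair agrees for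
  every copy, so \<open>F\<close> is constant on sparse sequences and a sparse copy is monochromatic. The range of
  \<open>F\<close> does not enter into the choice of \<open>N\<close>.
\<close>
lemma canonical_ramsey_placement:
  fixes \<sigma> :: "'n::finite \<Rightarrow> nat \<Rightarrow> nat"
  assumes \<sigma>: "\<And>i. strict_mono_on {..<k} (\<sigma> i)" "\<And>i q. q < k \<Longrightarrow> \<sigma> i q < M"
    and ne: "\<And>i j q. i \<noteq> j \<Longrightarrow> q < k \<Longrightarrow> \<sigma> i q \<noteq> \<sigma> j q"
  shows "\<exists>N::nat. \<forall>F :: (nat \<Rightarrow> nat) \<Rightarrow> 'c. (\<forall>u w. (\<forall>p<k. u p = w p) \<longrightarrow> F u = F w) \<longrightarrow>
    (\<exists>g. strict_mono_on {..<M} g \<and> g ` {..<M} \<subseteq> {..<N} \<and>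
      ((\<exists>c. \<forall>i. F (g \<circ> \<sigma> i) = c) \<or> inj (\<lambda>i. F (g \<circ> \<sigma> i))))"
proof -
  define T L where "T = Suc M" and "L = (T + Suc k) * Suc M ^ k"
  have LM: "Suc M * Suc M ^ k \<le> L" unfolding L_def T_def by (intro mult_le_mono1) simp
  obtain enc :: "('n \<times> 'n) set \<Rightarrow> nat" where enc: "bij_betw enc UNIV {..<card (UNIV :: ('n \<times> 'n) set set)}"
    using ex_bij_betw_finite_nat[of "UNIV :: ('n \<times> 'n) set set"] by (auto simp: atLeast0LessThan)
  define qs where "qs = replicate (card (UNIV :: ('n \<times> 'n) set set)) L"
  obtain N :: nat where N: "partn_lst {..<N} qs M" using ramsey_full by blast
  have "\<exists>g. strict_mono_on {..<M} g \<and> g ` {..<M} \<subseteq> {..<N} \<and>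
      ((\<exists>c. \<forall>i. F (g \<circ> \<sigma> i) = c) \<or> inj (\<lambda>i. F (g \<circ> \<sigma> i)))"
    if cong: "\<forall>u w. (\<forall>p<k. u p = w p) \<longrightarrow> F u = F w" for F :: "(nat \<Rightarrow> nat) \<Rightarrow> 'c"
  proof -
    define E where "E g = {(i, j). F (g \<circ> \<sigma> i) = F (g \<circ> \<sigma> j)}" for g
    \<comment> \<open>Only one increasing \<open>g\<close> has image \<open>X\<close>, so the choice in \<open>f\<close> is forced on \<open>M\<close>-sets.\<close>
    define f where "f X = enc (E (SOME g. strict_mono_on {..<M} g \<and> g ` {..<M} = X))" for X
    have f: "f (g ` {..<M}) = enc (E g)" if g: "strict_mono_on {..<M} g" for g
    proof -
      define h where "h = (SOME h. strict_mono_on {..<M} h \<and> h ` {..<M} = g ` {..<M})"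
      have "strict_mono_on {..<M} h \<and> h ` {..<M} = g ` {..<M}"
        unfolding h_def by (rule someI[of _ g]) (use g in simp)
      then have "h n = g n" if "n < M" for n
        using strict_mono_on_image_unique[of M h g n] g that by blast
      then have "F (h \<circ> \<sigma> i) = F (g \<circ> \<sigma> i)" for i
        using cong \<sigma>(2) by simp
      then have "E h = E g" by (simp add: E_def)
      then show ?thesis by (simp add: f_def h_def)
    qed
    have "f \<in> nsets {..<N} M \<rightarrow> {..<length qs}"
      using enc by (auto simp: f_def qs_def bij_betw_def)
    then obtain c H where c: "c < length qs" and H: "H \<in> nsets {..<N} (qs ! c)" and fH: "f ` (nsets H M) \<subseteq> {c}"
      using partn_lstE[OF N] by metis
    have Hc: "H \<subseteq> {..<N}" "finite H" "card H = L"
      using H c by (auto simp: nsets_def qs_def)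
    define h where "h = enumerate H"
    have h: "strict_mono_on {..<L} h" "h ` {..<L} \<subseteq> H"
      using finite_enumerate_mono[of _ _ H] finite_enumerate_in_set[of H] Hc
      by (auto simp: h_def strict_mono_on_def)
    have he: "strict_mono_on {..<M} (h \<circ> e) \<and> (h \<circ> e) ` {..<M} \<subseteq> {..<N} \<and> enc (E (h \<circ> e)) = c"
      if e: "strict_mono_on {..<M} e" "\<And>n. n < M \<Longrightarrow> e n < L" for e
    proof -
      have mono: "strict_mono_on {..<M} (h \<circ> e)"
        using h(1) e by (auto simp: strict_mono_on_def)
      have sub: "(h \<circ> e) ` {..<M} \<subseteq> H" using h(2) e(2) by auto
      have "(h \<circ> e) ` {..<M} \<in> nsets H M"
        using sub card_image[OF strict_mono_on_imp_inj_on[OF mono]] by (simp add: nsets_def)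
      then have "f ((h \<circ> e) ` {..<M}) = c" using fH by blast
      then show ?thesis using f[OF mono] mono sub Hc(1) by auto
    qed
    \<comment> \<open>The sparse copy that serves for both outcomes; \<open>Suc\<close> keeps its entries positive.\<close>
    define e0 where "e0 n = Suc n * Suc M ^ k" for n
    have e0: "strict_mono_on {..<M} e0" "\<And>n. n < M \<Longrightarrow> e0 n < L"
    proof -
      show "strict_mono_on {..<M} e0" by (auto simp: e0_def strict_mono_on_def simp del: mult_Suc)
      show "e0 n < L" if "n < M" for n
      proof -
        have "e0 n < Suc M * Suc M ^ k" using that by (simp add: e0_def del: mult_Suc)
        then show ?thesis using LM by linarith
      qed
    qed
    show ?thesis
    proof (rule exI[of _ "h \<circ> e0"], intro conjI)
      show "strict_mono_on {..<M} (h \<circ> e0)" "(h \<circ> e0) ` {..<M} \<subseteq> {..<N}" using he[OF e0] by auto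
      show "(\<exists>c. \<forall>i. F (h \<circ> e0 \<circ> \<sigma> i) = c) \<or> inj (\<lambda>i. F (h \<circ> e0 \<circ> \<sigma> i))"
      proof (rule disjCI)
        assume "\<not> inj (\<lambda>i. F (h \<circ> e0 \<circ> \<sigma> i))"
        then obtain i j where ij: "i \<noteq> j" "F (h \<circ> e0 \<circ> \<sigma> i) = F (h \<circ> e0 \<circ> \<sigma> j)"
          by (auto simp: inj_def)
        have inv: "F (h \<circ> (e \<circ> \<sigma> i)) = F (h \<circ> (e \<circ> \<sigma> j))"
          if "strict_mono_on {..<M} e" "\<And>n. n < M \<Longrightarrow> e n < (T + Suc k) * Suc M ^ k" for e
        proof -
          have "E (h \<circ> e) = E (h \<circ> e0)"
            using he[OF that(1)] he[OF e0] that(2) enc by (auto simp: L_def bij_betw_def dest: injD)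
          then show ?thesis using ij(2) by (auto simp: E_def o_assoc)
        qed
        have same: "F (h \<circ> e0 \<circ> \<sigma> l) = F (h \<circ> e0 \<circ> \<sigma> i)" for l
        proof -
          have "F (h \<circ> (\<lambda>p. Suc (\<sigma> l p) * Suc M ^ k)) = F (h \<circ> (\<lambda>p. Suc (\<sigma> i p) * Suc M ^ k))"
          proof (rule shift_invariance_imp_constant[where F = "\<lambda>u. F (h \<circ> u)" and T = T, OF _ \<sigma>(1)[of i] \<sigma>(2)[of _ i] \<sigma>(1)[of j] \<sigma>(2)[of _ j] ne[OF ij(1)] inv])
            show "F (h \<circ> u) = F (h \<circ> w)" if "\<And>p. p < k \<Longrightarrow> u p = w p" for u w
              using cong that by simp
            show "strict_mono_on {..<k} (\<lambda>p. Suc (\<sigma> l p))" "strict_mono_on {..<k} (\<lambda>p. Suc (\<sigma> i p))"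
              using \<sigma>(1) by (auto simp: strict_mono_on_def)
            show "0 < Suc (\<sigma> l q) \<and> Suc (\<sigma> l q) \<le> T" "0 < Suc (\<sigma> i q) \<and> Suc (\<sigma> i q) \<le> T" if "q < k" for q
              using \<sigma>(2)[of q l] \<sigma>(2)[of q i] that by (auto simp: T_def)
          qed
          then show ?thesis by (simp add: e0_def comp_def)
        qed
        then show "\<exists>c. \<forall>i. F (h \<circ> e0 \<circ> \<sigma> i) = c" by blast
      qed
    qed
  qed
  then show ?thesis by blast
qed

section \<open>Points of a spread and their distances\<close>
definition spread_point :: "nat \<Rightarrow> (nat \<Rightarrow> real) \<Rightarrow> (nat \<Rightarrow> nat) \<Rightarrow> nat \<Rightarrow> real" where
  "spread_point k a u m = (\<Sum>p<k. if u p = m then a p else 0)"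

text \<open>
  The inner product of two points of the spread, written without reference to an ambient
  dimension; this makes the invariance under relabelling of the axes evident.
\<close>
definition overlap :: "nat \<Rightarrow> (nat \<Rightarrow> real) \<Rightarrow> (nat \<Rightarrow> nat) \<Rightarrow> (nat \<Rightarrow> nat) \<Rightarrow> real" where
  "overlap k a u w = (\<Sum>p<k. \<Sum>q<k. if u p = w q then a p * a q else 0)"

definition spread_dist2 :: "nat \<Rightarrow> (nat \<Rightarrow> real) \<Rightarrow> (nat \<Rightarrow> nat) \<Rightarrow> (nat \<Rightarrow> nat) \<Rightarrow> real" where
  "spread_dist2 k a u w = overlap k a u u + overlap k a w w - 2 * overlap k a u w"

lemma overlap_eq_inner:
  assumes "\<And>p. p < k \<Longrightarrow> u p < n"
  shows "overlap k a u w = (\<Sum>m<n. spread_point k a u m * spread_point k a w m)"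
proof -
  have "(\<Sum>m<n. spread_point k a u m * spread_point k a w m)
      = (\<Sum>m<n. \<Sum>p<k. \<Sum>q<k. (if u p = m then a p else 0) * (if w q = m then a q else 0))"
    by (simp add: spread_point_def sum_product)
  also have "\<dots> = (\<Sum>p<k. \<Sum>m<n. \<Sum>q<k. (if u p = m then a p else 0) * (if w q = m then a q else 0))"
    by (rule sum.swap)
  also have "\<dots> = (\<Sum>p<k. \<Sum>q<k. \<Sum>m<n. (if u p = m then a p else 0) * (if w q = m then a q else 0))"
    by (intro sum.cong refl sum.swap)
  also have "\<dots> = overlap k a u w"
    unfolding overlap_def
  proof (intro sum.cong refl)
    fix p q assume "p \<in> {..<k}" "q \<in> {..<k}"
    have "(\<Sum>m<n. (if u p = m then a p else 0) * (if w q = m then a q else 0))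
        = (\<Sum>m<n. if m = u p then (if u p = w q then a p * a q else 0) else 0)"
      by (intro sum.cong) auto
    also have "\<dots> = (if u p = w q then a p * a q else 0)"
      using assms \<open>p \<in> {..<k}\<close> by simp
    finally show "(\<Sum>m<n. (if u p = m then a p else 0) * (if w q = m then a q else 0))
        = (if u p = w q then a p * a q else 0)" .
  qed
  finally show ?thesis ..
qed

lemma spread_dist2_eq_sum:
  assumes "\<And>p. p < k \<Longrightarrow> u p < n" "\<And>p. p < k \<Longrightarrow> w p < n"
  shows "spread_dist2 k a u w = (\<Sum>m<n. (spread_point k a u m - spread_point k a w m)\<^sup>2)"
  using overlap_eq_inner[of k u n a u, OF assms(1)] overlap_eq_inner[of k w n a w, OF assms(2)]
    overlap_eq_inner[of k u n a w, OF assms(1)]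
  by (simp add: spread_dist2_def power2_diff sum.distrib sum_subtractf sum_distrib_left mult.assoc
      flip: power2_eq_square)

lemma edist_spread_point:
  assumes "\<And>p. p < k \<Longrightarrow> u p < n" "\<And>p. p < k \<Longrightarrow> w p < n"
  shows "edist n (spread_point k a u) (spread_point k a w) = sqrt (spread_dist2 k a u w)"
  using assms by (simp add: edist_def L2_set_def dist_real_def spread_dist2_eq_sum[of k u n w])

lemma spread_point_in_Euclidean_space:
  assumes "\<And>p. p < k \<Longrightarrow> u p < n"
  shows "spread_point k a u \<in> topspace (Euclidean_space n)"
proof -
  have "spread_point k a u m = 0" if "m \<ge> n" for m
    unfolding spread_point_def using assms that by (intro sum.neutral) force
  then show ?thesis by (simp add: topspace_Euclidean_space)
qed

lemma spread_dist2_relabel: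
  assumes "inj_on g A" "u ` {..<k} \<subseteq> A" "w ` {..<k} \<subseteq> A"
  shows "spread_dist2 k a (g \<circ> u) (g \<circ> w) = spread_dist2 k a u w"
proof -
  have "overlap k a (g \<circ> u) (g \<circ> w) = overlap k a u w"
    if "u ` {..<k} \<subseteq> A" "w ` {..<k} \<subseteq> A" for u w
    unfolding overlap_def using that assms(1)
    by (intro sum.cong refl) (simp add: inj_on_eq_iff image_subset_iff)
  then show ?thesis using assms by (simp add: spread_dist2_def)
qed

section \<open>The cone of squared distance matrices\<close>

text \<open>
  The sequences are taken to be increasing on all of \<open>nat\<close> although only their first \<open>k\<close> entries
  determine a point: patterns with different \<open>k\<close> can then be put together without any side condition.
  That two sequences differ at every position is what the combinatorial part asks for.
\<close>
definition spread_matrices :: "(real ^ 'n ^ 'n) set" where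
  "spread_matrices = {D. \<exists>k a \<sigma>. (\<forall>i. strict_mono (\<sigma> i)) \<and> (\<forall>i j q. i \<noteq> j \<longrightarrow> \<sigma> i q \<noteq> \<sigma> j q) \<and>
      (\<forall>i j. D $ i $ j = spread_dist2 k a (\<sigma> i) (\<sigma> j))}"

lemma spread_matricesI:
  assumes "\<And>i. strict_mono (\<sigma> i)" "\<And>i j q. i \<noteq> j \<Longrightarrow> \<sigma> i q \<noteq> \<sigma> j q"
    "\<And>i j. D $ i $ j = spread_dist2 k a (\<sigma> i) (\<sigma> j)"
  shows "D \<in> spread_matrices"
  using assms unfolding spread_matrices_def by blast

lemma spread_matricesE:
  assumes "D \<in> spread_matrices"
  obtains k a \<sigma> where "\<And>i. strict_mono (\<sigma> i)" "\<And>i j q. i \<noteq> j \<Longrightarrow> \<sigma> i q \<noteq> \<sigma> j q"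
    "\<And>i j. D $ i $ j = spread_dist2 k a (\<sigma> i) (\<sigma> j)"
  using assms unfolding spread_matrices_def by blast

lemma spread_matrices_scale:
  assumes "D \<in> spread_matrices" "0 \<le> c"
  shows "c *\<^sub>R D \<in> spread_matrices"
proof -
  from assms(1) obtain k a \<sigma> where \<sigma>: "\<And>i. strict_mono (\<sigma> i)" "\<And>i j q. i \<noteq> j \<Longrightarrow> \<sigma> i q \<noteq> \<sigma> j q"
    and D: "\<And>i j. D $ i $ j = spread_dist2 k a (\<sigma> i) (\<sigma> j)"
    by (rule spread_matricesE) blast
  have "overlap k (\<lambda>p. sqrt c * a p) u w = c * overlap k a u w" for u w
  proof -
    have "(sqrt c * x) * (sqrt c * y) = (sqrt c)\<^sup>2 * (x * y)" for x y :: real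
      by (simp add: power2_eq_square)
    then have "(sqrt c * x) * (sqrt c * y) = c * (x * y)" for x y :: real
      using assms(2) by simp
    then show ?thesis unfolding overlap_def sum_distrib_left by (intro sum.cong refl) auto
  qed
  then have "(c *\<^sub>R D) $ i $ j = spread_dist2 k (\<lambda>p. sqrt c * a p) (\<sigma> i) (\<sigma> j)" for i j
    by (simp add: D spread_dist2_def algebra_simps)
  then show ?thesis using \<sigma> by (rule spread_matricesI[rotated 2])
qed

lemma sum_lessThan_add:
  fixes f :: "nat \<Rightarrow> 'a::comm_monoid_add"
  shows "(\<Sum>p<m + n. f p) = (\<Sum>p<m. f p) + (\<Sum>p<n. f (m + p))"
  by (induction n) (simp_all add: add.assoc)

text \<open>
  The two patterns are put side by side on disjoint sets of axes, so squared distances add up.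
  The first pattern ends before axis \<open>M\<close>.
\<close>
lemma spread_matrices_add:
  assumes "D \<in> (spread_matrices :: (real ^ 'n::finite ^ 'n) set)" "E \<in> spread_matrices"
  shows "D + E \<in> spread_matrices"
proof -
  from assms(1) obtain k a \<sigma> where \<sigma>: "\<And>i. strict_mono (\<sigma> i)" "\<And>i j q. i \<noteq> j \<Longrightarrow> \<sigma> i q \<noteq> \<sigma> j q"
    and D: "\<And>i j. D $ i $ j = spread_dist2 k a (\<sigma> i) (\<sigma> j)"
    by (rule spread_matricesE) blast
  from assms(2) obtain l b \<tau> where \<tau>: "\<And>i. strict_mono (\<tau> i)" "\<And>i j q. i \<noteq> j \<Longrightarrow> \<tau> i q \<noteq> \<tau> j q"
    and E: "\<And>i j. E $ i $ j = spread_dist2 l b (\<tau> i) (\<tau> j)"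
    by (rule spread_matricesE) blast
  define M where "M = Suc (\<Sum>i\<in>UNIV. \<sigma> i k)"
  have M: "\<sigma> i p < M" if "p < k" for i p
  proof -
    have "\<sigma> i p < \<sigma> i k" using \<sigma>(1) that by (rule strict_monoD)
    also have "\<dots> \<le> (\<Sum>i\<in>UNIV. \<sigma> i k)" by (rule member_le_sum) auto
    finally show ?thesis by (simp add: M_def)
  qed
  define c where "c p = (if p < k then a p else b (p - k))" for p
  define \<rho> where "\<rho> i p = (if p < k then \<sigma> i p else M + \<tau> i (p - k))" for i p
  have "overlap (k + l) c (\<rho> i) (\<rho> j) = overlap k a (\<sigma> i) (\<sigma> j) + overlap l b (\<tau> i) (\<tau> j)" for i j
  proof -
    have "\<sigma> i p \<noteq> M + x" "M + x \<noteq> \<sigma> i p" if "p < k" for i p x using M[OF that, of i] by auto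
    then show ?thesis unfolding overlap_def sum_lessThan_add
      by (simp add: \<rho>_def c_def sum.distrib cong: if_cong)
  qed
  then have "(D + E) $ i $ j = spread_dist2 (k + l) c (\<rho> i) (\<rho> j)" for i j
    by (simp add: D E spread_dist2_def)
  moreover have "strict_mono (\<rho> i)" for i
  proof (rule strict_monoI)
    fix p q :: nat assume "p < q"
    then show "\<rho> i p < \<rho> i q"
      using M[of p i] strict_monoD[OF \<sigma>(1), of p q i] strict_monoD[OF \<tau>(1), of "p - k" "q - k" i]
      by (auto simp: \<rho>_def)
  qed
  moreover have "\<rho> i q \<noteq> \<rho> j q" if "i \<noteq> j" for i j q
    using \<sigma>(2)[OF that] \<tau>(2)[OF that] by (simp add: \<rho>_def)
  ultimately show ?thesis by (intro spread_matricesI[of \<rho>])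
qed

lemma ex_inj_nat: "\<exists>\<iota> :: 'n::finite \<Rightarrow> nat. inj \<iota> \<and> (\<forall>i. \<iota> i < CARD('n))"
proof -
  obtain \<iota> :: "'n \<Rightarrow> nat" where "bij_betw \<iota> UNIV {0..<CARD('n)}"
    using ex_bij_betw_finite_nat[of "UNIV :: 'n set"] by auto
  then show ?thesis by (intro exI[of _ \<iota>]) (auto simp: bij_betw_def set_eq_iff image_iff)
qed

lemma convex_spread_matrices: "convex (spread_matrices :: (real ^ 'n::finite ^ 'n) set)"
  by (simp add: convex_def spread_matrices_add spread_matrices_scale)

lemma zero_in_spread_matrices: "0 \<in> (spread_matrices :: (real ^ 'n::finite ^ 'n) set)"
proof -
  obtain \<iota> :: "'n \<Rightarrow> nat" where "inj \<iota>" using ex_inj_nat by blast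
  then show ?thesis
    by (intro spread_matricesI[of "\<lambda>i p. \<iota> i + p" _ 0 "\<lambda>_. 0"])
       (auto simp: strict_mono_def spread_dist2_def overlap_def inj_eq)
qed

text \<open>
  The coefficients rise from \<open>0\<close> to \<open>N\<close> and fall back to \<open>0\<close> with slope \<open>1\<close>. Shifting them by
  \<open>x i\<close> and by \<open>x j\<close> gives two points whose coordinates differ by exactly \<open>\<bar>x i - x j\<bar>\<close> on both slopes.
  Only the at most \<open>3 * X\<close> axes near the two ends and the peak deviate, each by at most \<open>X\<^sup>2\<close> in the
  square, however large \<open>N\<close> is.
\<close>
lemma triangular_wave_spread:
  fixes x :: "'n::finite \<Rightarrow> nat"
  assumes "inj x" and X: "\<And>i. x i \<le> X"
  shows "\<exists>D \<in> spread_matrices. \<forall>i j.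
    \<bar>D $ i $ j - real (2 * N + X) * (real (x i) - real (x j))\<^sup>2\<bar> \<le> real (3 * X) * (real X)\<^sup>2"
proof -
  define A where "A t = max 0 (real N - \<bar>t - real N\<bar>)" for t
  define a where "a p = A (real p)" for p
  define \<sigma> where "\<sigma> i p = x i + p" for i p
  define D where "D = (\<chi> i j. spread_dist2 (2 * N) a (\<sigma> i) (\<sigma> j))"
  have "D \<in> spread_matrices"
    using \<open>inj x\<close> by (intro spread_matricesI[of \<sigma> _ "2 * N" a]) (auto simp: strict_mono_def \<sigma>_def D_def inj_eq)
  moreover have "\<bar>D $ i $ j - real (2 * N + X) * (real (x i) - real (x j))\<^sup>2\<bar> \<le> real (3 * X) * (real X)\<^sup>2" for i j
  proof -
    define n where "n = 2 * N + X"
    define s where "s = real (x i) - real (x j)"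
    \<comment> \<open>Off \<open>B\<close> both shifted waves are on the same slope.\<close>
    define B where "B = {..<X} \<union> {N..<N + X} \<union> {2 * N..<2 * N + X}"
    define d where "d m = A (real m - real (x i)) - A (real m - real (x j))" for m
    have pt: "spread_point (2 * N) a (\<sigma> i) m = A (real m - real (x i))" for m i
    proof -
      have "spread_point (2 * N) a (\<sigma> i) m
          = (\<Sum>p<2 * N. if p = m - x i then (if x i \<le> m then a p else 0) else 0)"
        unfolding spread_point_def \<sigma>_def by (intro sum.cong refl) auto
      also have "\<dots> = A (real m - real (x i))"
        by (auto simp: a_def A_def of_nat_diff)
      finally show ?thesis .
    qed
    have bound: "\<sigma> i p < n" if "p < 2 * N" for i p using that X[of i] by (simp add: \<sigma>_def n_def)
    have D: "D $ i $ j = (\<Sum>m<n. (d m)\<^sup>2)"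
      by (simp add: D_def d_def spread_dist2_eq_sum[OF bound bound] pt)
    have s: "\<bar>s\<bar> \<le> real X" using X[of i] X[of j] by (simp add: s_def)
    have d_le: "\<bar>d m\<bar> \<le> \<bar>s\<bar>" for m
      unfolding d_def s_def A_def by (auto simp: max_def abs_if)
    have d_eq: "\<bar>d m\<bar> = \<bar>s\<bar>" if "m < n" "m \<notin> B" for m
    proof -
      have "X \<le> m \<and> m < N \<or> N + X \<le> m \<and> m < 2 * N"
        using that by (auto simp: B_def n_def)
      then have "real X \<le> real m \<and> real m < real N \<or> real N + real X \<le> real m \<and> real m < 2 * real N"
        by (metis of_nat_add of_nat_le_iff of_nat_less_iff of_nat_mult of_nat_numeral)
      then show ?thesis using X[of i, folded of_nat_le_iff[where 'a = real]] X[of j, folded of_nat_le_iff[where 'a = real]]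
        unfolding d_def s_def A_def by (auto simp: max_def)
    qed
    have err: "\<bar>(d m)\<^sup>2 - s\<^sup>2\<bar> \<le> (if m \<in> B then (real X)\<^sup>2 else 0)" if "m < n" for m
    proof (cases "m \<in> B")
      case True
      have "0 \<le> (d m)\<^sup>2" "(d m)\<^sup>2 \<le> s\<^sup>2" "s\<^sup>2 \<le> (real X)\<^sup>2"
        using d_le[of m] s by (simp_all flip: abs_le_square_iff)
      then have "\<bar>(d m)\<^sup>2 - s\<^sup>2\<bar> \<le> (real X)\<^sup>2" by linarith
      then show ?thesis using True by simp
    next
      case False
      then show ?thesis using d_eq[OF that False] by (simp add: power2_eq_iff abs_eq_iff)
    qed
    have "\<bar>D $ i $ j - real n * s\<^sup>2\<bar> = \<bar>\<Sum>m<n. (d m)\<^sup>2 - s\<^sup>2\<bar>"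
      by (simp add: D sum_subtractf)
    also have "\<dots> \<le> (\<Sum>m<n. if m \<in> B then (real X)\<^sup>2 else 0)"
      by (rule order_trans[OF sum_abs sum_mono]) (use err in auto)
    also have "\<dots> = real (card ({..<n} \<inter> B)) * (real X)\<^sup>2"
      by (simp add: sum.If_cases)
    also have "\<dots> \<le> real (3 * X) * (real X)\<^sup>2"
    proof -
      have "card ({..<n} \<inter> B) \<le> card B" by (intro card_mono) (auto simp: B_def)
      also have "\<dots> \<le> card {..<X} + card {N..<N + X} + card {2 * N..<2 * N + X}"
        unfolding B_def by (intro order_trans[OF card_Un_le] add_mono card_Un_le) auto
      finally show ?thesis by (intro mult_right_mono) auto
    qed
    finally show ?thesis by (simp add: n_def s_def)
  qed
  ultimately show ?thesis by blast
qed

section \<open>Nonnegative forms in pairwise differences\<close>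
text \<open>
  The pairing of \<open>y\<close> with the squared distances of points \<open>x i\<close> on a line, as a quadratic form in
  their positions.
\<close>
definition pair_form :: "real ^ 'n ^ 'n \<Rightarrow> ('n \<Rightarrow> real) \<Rightarrow> real" where
  "pair_form y x = (\<Sum>i\<in>UNIV. \<Sum>j\<in>UNIV. y $ i $ j * (x i - x j)\<^sup>2)"

lemma pair_form_scale: "pair_form y (\<lambda>i. c * x i) = c\<^sup>2 * pair_form y x"
proof -
  have "(c * s - c * t)\<^sup>2 = c\<^sup>2 * (s - t)\<^sup>2" for s t :: real
    by (simp add: power_mult_distrib flip: right_diff_distrib)
  then show ?thesis by (simp add: pair_form_def sum_distrib_left mult.left_commute)
qed

lemma pair_form_translate: "pair_form y (\<lambda>i. x i + c) = pair_form y x"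
  by (simp add: pair_form_def)

lemma pair_form_parallelogram:
  "pair_form y (\<lambda>i. u i + v i) + pair_form y (\<lambda>i. u i - v i) = 2 * pair_form y u + 2 * pair_form y v"
proof -
  have "c * (u i + v i - (u j + v j))\<^sup>2 + c * (u i - v i - (u j - v j))\<^sup>2
      = 2 * (c * (u i - u j)\<^sup>2) + 2 * (c * (v i - v j)\<^sup>2)" for c i j
    by (simp add: power2_eq_square algebra_simps)
  then show ?thesis
    by (simp add: pair_form_def sum_distrib_left flip: sum.distrib)
qed

text \<open>
  A triangular wave of length about \<open>2 * N\<close> pairs with \<open>y\<close> to \<open>2 * N\<close> times the form up to an error
  that stays bounded as \<open>N\<close> grows, so a negative value of the form would make the pairing negative.
\<close>
lemma pair_form_nonneg_nat:
  fixes y :: "real ^ 'n::finite ^ 'n" and x :: "'n \<Rightarrow> nat"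
  assumes y: "\<And>D. D \<in> spread_matrices \<Longrightarrow> 0 \<le> y \<bullet> D" and x: "inj x"
  shows "0 \<le> pair_form y (\<lambda>i. real (x i))"
proof (rule ccontr)
  assume "\<not> ?thesis"
  then have neg: "pair_form y (\<lambda>i. real (x i)) < 0" by simp
  define X where "X = (\<Sum>i\<in>UNIV. x i)"
  have X: "x i \<le> X" for i unfolding X_def by (rule member_le_sum) auto
  define K where "K = (\<Sum>i\<in>UNIV. \<Sum>j\<in>UNIV. \<bar>y $ i $ j\<bar>) * (real (3 * X) * (real X)\<^sup>2)"
  have "0 \<le> real (2 * N + X) * pair_form y (\<lambda>i. real (x i)) + K" for N
  proof -
    obtain D where D: "D \<in> spread_matrices" and close:
      "\<And>i j. \<bar>D $ i $ j - real (2 * N + X) * (real (x i) - real (x j))\<^sup>2\<bar> \<le> real (3 * X) * (real X)\<^sup>2"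
      using triangular_wave_spread[OF x X, of N] by blast
    have "y \<bullet> D = (\<Sum>i\<in>UNIV. \<Sum>j\<in>UNIV. y $ i $ j * D $ i $ j)"
      by (simp add: inner_vec_def)
    also have "\<dots> \<le> (\<Sum>i\<in>UNIV. \<Sum>j\<in>UNIV. real (2 * N + X) * (y $ i $ j * (real (x i) - real (x j))\<^sup>2)
        + \<bar>y $ i $ j\<bar> * (real (3 * X) * (real X)\<^sup>2))"
    proof (intro sum_mono)
      fix i j
      define e where "e = D $ i $ j - real (2 * N + X) * (real (x i) - real (x j))\<^sup>2"
      have "y $ i $ j * e \<le> \<bar>y $ i $ j\<bar> * \<bar>e\<bar>" by (metis abs_ge_self abs_mult)
      also have "\<dots> \<le> \<bar>y $ i $ j\<bar> * (real (3 * X) * (real X)\<^sup>2)"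
        using close[of i j] by (intro mult_left_mono) (auto simp: e_def)
      finally show "y $ i $ j * D $ i $ j \<le> real (2 * N + X) * (y $ i $ j * (real (x i) - real (x j))\<^sup>2)
        + \<bar>y $ i $ j\<bar> * (real (3 * X) * (real X)\<^sup>2)"
        unfolding e_def by (simp add: right_diff_distrib mult.left_commute)
    qed
    also have "\<dots> = real (2 * N + X) * pair_form y (\<lambda>i. real (x i)) + K"
      by (simp only: pair_form_def K_def sum.distrib sum_distrib_left sum_distrib_right)
    finally show ?thesis using y[OF D] by linarith
  qed
  moreover obtain N :: nat where "K / - pair_form y (\<lambda>i. real (x i)) < real N"
    using reals_Archimedean2 by blast
  then have "K < real N * - pair_form y (\<lambda>i. real (x i))" using neg by (simp add: field_simps)
  moreover have "real N * - pair_form y (\<lambda>i. real (x i)) \<le> real (2 * N + X) * - pair_form y (\<lambda>i. real (x i))"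
    using neg by (intro mult_right_mono) auto
  ultimately show False by (smt (verit) mult_minus_right)
qed

text \<open>
  Real positions are translated to be nonnegative and approximated by distinct naturals on a finer and
  finer scale. Multiplying the rounded values by the number \<open>c\<close> of points and adding \<open>\<iota> i < c\<close>
  makes them distinct at a cost that vanishes in the limit.
\<close>
lemma pair_form_nonneg:
  fixes y :: "real ^ 'n::finite ^ 'n" and x :: "'n \<Rightarrow> real"
  assumes y: "\<And>D. D \<in> spread_matrices \<Longrightarrow> 0 \<le> y \<bullet> D"
  shows "0 \<le> pair_form y x"
proof -
  obtain \<iota> :: "'n \<Rightarrow> nat" where \<iota>: "inj \<iota>" "\<And>i. \<iota> i < CARD('n)" using ex_inj_nat by blast
  define c where "c = CARD('n)"
  define t where "t i = x i + (\<Sum>j\<in>UNIV. \<bar>x j\<bar>)" for i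
  have t: "0 \<le> t i" for i
  proof -
    have "\<bar>x i\<bar> \<le> (\<Sum>j\<in>UNIV. \<bar>x j\<bar>)" by (rule member_le_sum) auto
    then show ?thesis by (simp add: t_def)
  qed
  define z where "z m i = nat \<lfloor>real (Suc m) * t i\<rfloor> * c + \<iota> i" for m i
  have "inj (z m)" for m
  proof (rule injI)
    fix i j assume "z m i = z m j"
    then have "z m i mod c = z m j mod c" by simp
    then show "i = j" using \<iota> by (simp add: z_def c_def inj_eq)
  qed
  then have pos: "0 \<le> pair_form y (\<lambda>i. real (z m i))" for m
    by (intro pair_form_nonneg_nat y) auto
  have "(\<lambda>m. real (z m i) / real (Suc m)) \<longlonglongrightarrow> c * t i" for i
  proof (rule LIM_zero_cancel, rule Lim_null_comparison)
    show "\<forall>\<^sub>F m in sequentially. norm (real (z m i) / real (Suc m) - real c * t i) \<le> 2 * real c * inverse (real (Suc m))"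
    proof (rule always_eventually, rule allI)
      fix m
      define f where "f = real (nat \<lfloor>real (Suc m) * t i\<rfloor>)"
      have f: "f \<le> real (Suc m) * t i" "real (Suc m) * t i < f + 1"
        using t[of i] unfolding f_def by (simp_all del: of_nat_Suc) 
      have "\<bar>real (z m i) - real c * (real (Suc m) * t i)\<bar> \<le> 2 * real c"
      proof -
        have "real (z m i) - real c * (real (Suc m) * t i) = real (\<iota> i) - real c * (real (Suc m) * t i - f)"
          by (simp add: z_def f_def algebra_simps)
        moreover have "0 \<le> real c * (real (Suc m) * t i - f)" "real c * (real (Suc m) * t i - f) \<le> real c * 1"
          by (intro mult_nonneg_nonneg mult_left_mono; use f in \<open>simp del: of_nat_Suc\<close>)+
        moreover have "real (\<iota> i) \<le> real c" "0 \<le> real (\<iota> i)" using \<iota>(2)[of i] by (simp_all add: c_def)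
        ultimately show ?thesis by linarith
      qed
      then have "\<bar>real (z m i) - real c * (real (Suc m) * t i)\<bar> / real (Suc m) \<le> 2 * real c / real (Suc m)"
        by (rule divide_right_mono) simp
      moreover have "real (z m i) / real (Suc m) - real c * t i
          = (real (z m i) - real c * (real (Suc m) * t i)) / real (Suc m)"
        by (simp add: diff_divide_distrib del: of_nat_Suc)
      ultimately show "norm (real (z m i) / real (Suc m) - real c * t i) \<le> 2 * real c * inverse (real (Suc m))"
        by (simp only: real_norm_def abs_mult abs_inverse abs_of_nat divide_inverse)
    qed
    show "(\<lambda>m. 2 * real c * inverse (real (Suc m))) \<longlonglongrightarrow> 0"
      using tendsto_mult_right_zero[OF LIMSEQ_inverse_real_of_nat] by simp
  qed
  then have lim: "(\<lambda>m. pair_form y (\<lambda>i. real (z m i) / real (Suc m))) \<longlonglongrightarrow> pair_form y (\<lambda>i. c * t i)"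
    unfolding pair_form_def by (intro tendsto_intros)
  have "pair_form y (\<lambda>i. real (z m i) / real (Suc m)) \<ge> 0" for m
    using pair_form_scale[of y "inverse (real (Suc m))" "\<lambda>i. real (z m i)"] pos[of m]
    by (simp add: divide_inverse_commute del: of_nat_Suc)
  then have "0 \<le> pair_form y (\<lambda>i. c * t i)"
    by (intro tendsto_lowerbound[OF lim]) auto
  then have "0 \<le> pair_form y t"
    by (simp add: pair_form_scale zero_le_mult_iff c_def)
  then show ?thesis by (simp add: t_def[abs_def] pair_form_translate)
qed

text \<open>
  The barycentric coordinate of the vertex \<open>p l\<close> is an affine function on the whole space.
\<close>
lemma affine_independent_coordinate:
  fixes p :: "'n \<Rightarrow> 'a::euclidean_space"
  assumes p: "inj p" "\<not> affine_dependent (range p)"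
  shows "\<exists>w c. \<forall>i. p i \<bullet> w = c + (if i = l then 1 else 0)"
proof (cases "\<exists>l'. l' \<noteq> l")
  case False
  then show ?thesis by (intro exI[of _ 0] exI[of _ "-1"]) auto
next
  case True
  then obtain l' where l': "l' \<noteq> l" by blast
  define B where "B = (\<lambda>x. - p l' + x) ` (range p - {p l'})"
  have "independent B"
    using p(2) affine_dependent_iff_dependent2[of "p l'" "range p"] by (simp add: B_def)
  then obtain g :: "'a \<Rightarrow> real" where g: "linear g" and gB: "\<And>b. b \<in> B \<Longrightarrow> g b = (if b = p l - p l' then 1 else 0)"
    using linear_independent_extend[of B "\<lambda>b. if b = p l - p l' then 1 else 0 :: real"] by blast
  have g_inner: "g x = x \<bullet> adjoint g 1" for x using adjoint_works[OF g, of x 1] by simp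
  have "p i \<bullet> adjoint g 1 = g (p l') + (if i = l then 1 else 0)" for i
  proof (cases "i = l'")
    case True then show ?thesis using l' by (simp add: g_inner)
  next
    case False
    then have "p i - p l' \<in> B" using p(1) by (auto simp: B_def inj_eq image_iff)
    then have "g (p i - p l') = (if i = l then 1 else 0)" using gB p(1) by (simp add: inj_eq)
    then show ?thesis by (simp add: linear_diff[OF g] flip: g_inner)
  qed
  then show ?thesis by blast
qed

text \<open>
  For a nonnegative form the parallelogram identity shows that its zeros are closed under addition.
  So the form vanishes at \<open>u + v\<close> for any two unit vectors \<open>u \<noteq> v\<close>, and polarisation reads off the
  corresponding entry of \<open>y\<close>.
\<close>
lemma pair_form_eq_0_imp_eq_0:
  fixes y :: "real ^ 'n::finite ^ 'n"
  assumes nonneg: "\<And>x. 0 \<le> pair_form y x"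
    and zero: "\<And>l. pair_form y (\<lambda>i. if i = l then 1 else 0) = 0"
    and sym: "\<And>i j. y $ i $ j = y $ j $ i" and diag: "\<And>i. y $ i $ i = 0"
  shows "y = 0"
proof -
  have "y $ k $ l = 0" if "k \<noteq> l" for k l
  proof -
    define u v :: "'n \<Rightarrow> real" where "u i = (if i = k then 1 else 0)" and "v i = (if i = l then 1 else 0)" for i
    have 0: "pair_form y u = 0" "pair_form y v = 0" unfolding u_def v_def by (rule zero)+
    have "pair_form y (\<lambda>i. u i + v i) = 0"
      using pair_form_parallelogram[of y u v] 0 nonneg[of "\<lambda>i. u i + v i"] nonneg[of "\<lambda>i. u i - v i"] by linarith
    also have "pair_form y (\<lambda>i. u i + v i)
        = pair_form y u + pair_form y v + 2 * (\<Sum>i\<in>UNIV. \<Sum>j\<in>UNIV. y $ i $ j * ((u i - u j) * (v i - v j)))"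
    proof -
      have "c * (u i + v i - (u j + v j))\<^sup>2
        = c * (u i - u j)\<^sup>2 + c * (v i - v j)\<^sup>2 + 2 * (c * ((u i - u j) * (v i - v j)))" for c i j
        by (simp add: power2_eq_square algebra_simps)
      then show ?thesis by (simp only: pair_form_def sum.distrib sum_distrib_left)
    qed
    also have "(\<Sum>i\<in>UNIV. \<Sum>j\<in>UNIV. y $ i $ j * ((u i - u j) * (v i - v j)))
        = (\<Sum>i\<in>UNIV. \<Sum>j\<in>UNIV. (if i = k then if j = l then - y $ i $ j else 0 else 0)
            + (if i = l then if j = k then - y $ i $ j else 0 else 0))"
      using that by (intro sum.cong refl) (auto simp: u_def v_def)
    also have "\<dots> = - y $ k $ l - y $ l $ k"
    proof -
      have "(\<Sum>i\<in>UNIV. \<Sum>j\<in>UNIV. if i = k then if j = l then - y $ i $ j else 0 else 0) = - y $ k $ l" for k l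
      proof -
        have "(\<Sum>j\<in>UNIV. if i = k then if j = l then - y $ i $ j else 0 else 0) = (if i = k then - y $ i $ l else 0)" for i
          by simp
        then show ?thesis by simp
      qed
      then show ?thesis by (simp add: sum.distrib)
    qed
    finally show ?thesis using 0 sym[of k l] by simp
  qed
  then show ?thesis using diag by (metis (no_types, lifting) vec_eq_iff zero_index)
qed

section \<open>Placing simplices in a spread\<close>

text \<open>
  If the matrix \<open>D\<close> of the simplex were not in the cone, a hyperplane with normal vector \<open>y\<close>, itself
  symmetric with zero diagonal, would separate them. Its form is nonnegative, and by Pythagoras
  \<open>y \<bullet> D \<le> 0\<close> is the sum of its values on the coordinates of the vertices. So it vanishes on these, hence
  on the values of every affine function at the vertices, and affine independence forces \<open>y = 0\<close>.
\<close>
lemma distance_matrix_in_spread_matrices: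
  fixes p :: "'n::finite \<Rightarrow> 'a::euclidean_space"
  assumes p: "inj p" "\<not> affine_dependent (range p)"
  shows "(\<chi> i j. (dist (p i) (p j))\<^sup>2) \<in> spread_matrices"
proof (rule ccontr)
  define D :: "real ^ 'n ^ 'n" where "D = (\<chi> i j. (dist (p i) (p j))\<^sup>2)"
  assume "\<not> ?thesis"
  then have "D \<notin> spread_matrices" by (simp add: D_def)
  then obtain y b where y: "D + y \<in> affine hull (insert D spread_matrices)" "y \<noteq> 0" "y \<bullet> D \<le> b"
    and yb: "\<And>E. E \<in> spread_matrices \<Longrightarrow> b \<le> y \<bullet> E"
    using separating_hyperplane_set_point_inaff[OF convex_spread_matrices _ \<open>D \<notin> spread_matrices\<close>]
      zero_in_spread_matrices by (metis empty_iff)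
  define V where "V = {A :: real ^ 'n ^ 'n. (\<forall>i j. A $ i $ j = A $ j $ i) \<and> (\<forall>i. A $ i $ i = 0)}"
  have "subspace V" by (auto simp: V_def subspace_def)
  have DV: "D \<in> V" by (simp add: D_def V_def dist_commute)
  have "E \<in> V" if "E \<in> spread_matrices" for E
  proof -
    have sw: "overlap k a u w = overlap k a w u" for k a u w
      unfolding overlap_def by (subst sum.swap) (auto intro!: sum.cong)
    from that show ?thesis
      by (rule spread_matricesE) (simp add: V_def spread_dist2_def, metis sw add.commute)
  qed
  then have "affine hull (insert D spread_matrices) \<subseteq> V"
    using DV \<open>subspace V\<close> by (intro hull_minimal subspace_imp_affine) auto
  then have "D + y \<in> V" using y(1) by blast
  then have "y \<in> V" using subspace_diff[OF \<open>subspace V\<close> _ DV, of "D + y"] by simp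
  have "b \<le> 0" using yb[OF zero_in_spread_matrices] by simp
  have cone: "0 \<le> y \<bullet> E" if E: "E \<in> spread_matrices" for E
  proof (rule ccontr)
    assume "\<not> 0 \<le> y \<bullet> E"
    then have neg: "y \<bullet> E < 0" by simp
    \<comment> \<open>Scaled by \<open>c\<close>, the matrix pairs with \<open>y\<close> to \<open>b - 1\<close>, below the bound \<open>b\<close> of the cone.\<close>
    define c where "c = (1 - b) / - (y \<bullet> E)"
    have "0 \<le> c" using neg \<open>b \<le> 0\<close> by (simp add: c_def divide_nonneg_neg)
    then have "b \<le> y \<bullet> (c *\<^sub>R E)" using E by (intro yb spread_matrices_scale)
    also have "\<dots> = b - 1" using neg by (simp add: c_def)
    finally show False by simp
  qed
  have nonneg: "0 \<le> pair_form y x" for x by (rule pair_form_nonneg[OF cone])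
  have "y \<bullet> D = (\<Sum>v\<in>Basis. pair_form y (\<lambda>i. p i \<bullet> v))"
  proof -
    have "(dist (p i) (p j))\<^sup>2 = (\<Sum>v\<in>Basis. (p i \<bullet> v - p j \<bullet> v)\<^sup>2)" for i j
      unfolding euclidean_dist_l2[of "p i" "p j"] L2_set_def by (simp add: dist_real_def sum_nonneg)
    then have "y \<bullet> D = (\<Sum>i\<in>UNIV. \<Sum>j\<in>UNIV. \<Sum>v\<in>Basis. y $ i $ j * (p i \<bullet> v - p j \<bullet> v)\<^sup>2)"
      by (simp add: D_def inner_vec_def sum_distrib_left)
    also have "\<dots> = (\<Sum>i\<in>UNIV. \<Sum>v\<in>Basis. \<Sum>j\<in>UNIV. y $ i $ j * (p i \<bullet> v - p j \<bullet> v)\<^sup>2)"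
      by (intro sum.cong refl sum.swap)
    also have "\<dots> = (\<Sum>v\<in>Basis. pair_form y (\<lambda>i. p i \<bullet> v))"
      unfolding pair_form_def by (rule sum.swap)
    finally show ?thesis .
  qed
  then have "(\<Sum>v\<in>Basis. pair_form y (\<lambda>i. p i \<bullet> v)) = 0"
    using y(3) \<open>b \<le> 0\<close> by (intro antisym sum_nonneg nonneg) auto
  then have basis: "pair_form y (\<lambda>i. p i \<bullet> v) = 0" if "v \<in> Basis" for v
    using that by (subst (asm) sum_nonneg_eq_0_iff) (auto simp: nonneg)
  define Z where "Z = {w. pair_form y (\<lambda>i. p i \<bullet> w) = 0}"
  have "subspace Z"
  proof (rule subspaceI)
    show "0 \<in> Z" by (simp add: Z_def pair_form_def)
    show "c *\<^sub>R w \<in> Z" if "w \<in> Z" for c w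
      using that pair_form_scale[of y c "\<lambda>i. p i \<bullet> w"] by (simp add: Z_def)
    show "v + w \<in> Z" if "v \<in> Z" "w \<in> Z" for v w
      using that pair_form_parallelogram[of y "\<lambda>i. p i \<bullet> v" "\<lambda>i. p i \<bullet> w"]
        nonneg[of "\<lambda>i. p i \<bullet> v + p i \<bullet> w"] nonneg[of "\<lambda>i. p i \<bullet> v - p i \<bullet> w"]
      by (simp add: Z_def inner_add_right)
  qed
  then have "span Basis \<subseteq> Z" using basis by (intro span_minimal) (auto simp: Z_def)
  then have null: "pair_form y (\<lambda>i. p i \<bullet> w) = 0" for w by (auto simp: Z_def)
  have "pair_form y (\<lambda>i. if i = l then 1 else 0) = 0" for l
  proof -
    obtain w c where "\<And>i. p i \<bullet> w = c + (if i = l then 1 else 0)"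
      using affine_independent_coordinate[OF p, of l] by blast
    then have "(\<lambda>i. p i \<bullet> w) = (\<lambda>i. (if i = l then 1 else 0) + c)" by auto
    then show ?thesis using null[of w] by (simp add: pair_form_translate)
  qed
  then have "y = 0" using nonneg \<open>y \<in> V\<close> by (intro pair_form_eq_0_imp_eq_0) (auto simp: V_def)
  then show False using y(2) by simp
qed

text \<open>
  Relabelling the axes preserves the distances within a pattern that realises the simplex, so the
  copy found by \<open>canonical_ramsey_placement\<close> is congruent to it. The threshold \<open>n0\<close> is the number of
  axes required there, which is why it does not depend on \<open>r\<close>.
\<close>
lemma simplex_gallai_ramsey:
  fixes p :: "'n::finite \<Rightarrow> 'a::euclidean_space"
  assumes p: "inj p" "\<not> affine_dependent (range p)"
  shows "\<exists>n0. \<forall>r. \<forall>n\<ge>n0. gallai_ramsey n r (range p) (range p)"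
proof -
  obtain k a \<sigma> where mono: "\<And>i. strict_mono (\<sigma> i)" and ne: "\<And>i j q. i \<noteq> j \<Longrightarrow> \<sigma> i q \<noteq> \<sigma> j q"
    and "\<And>i j. (\<chi> i j. (dist (p i) (p j))\<^sup>2) $ i $ j = spread_dist2 k a (\<sigma> i) (\<sigma> j)"
    by (rule spread_matricesE[OF distance_matrix_in_spread_matrices[OF p]]) blast
  then have dist: "dist (p i) (p j) = sqrt (spread_dist2 k a (\<sigma> i) (\<sigma> j))" for i j
    by (metis (no_types, lifting) vec_lambda_beta real_sqrt_unique zero_le_dist)
  define M where "M = (\<Sum>i\<in>UNIV. \<sigma> i k)"
  have M: "\<sigma> i q < M" if "q < k" for i q
  proof -
    have "\<sigma> i q < \<sigma> i k" using mono that by (rule strict_monoD)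
    also have "\<dots> \<le> M" unfolding M_def by (rule member_le_sum) auto
    finally show ?thesis .
  qed
  obtain N where N: "\<And>F :: (nat \<Rightarrow> nat) \<Rightarrow> nat. (\<forall>u w. (\<forall>p<k. u p = w p) \<longrightarrow> F u = F w) \<Longrightarrow>
    \<exists>g. strict_mono_on {..<M} g \<and> g ` {..<M} \<subseteq> {..<N} \<and>
      ((\<exists>c. \<forall>i. F (g \<circ> \<sigma> i) = c) \<or> inj (\<lambda>i. F (g \<circ> \<sigma> i)))"
    using canonical_ramsey_placement[of k \<sigma> M, where 'c = nat, OF _ M ne] mono
    by (auto simp: strict_mono_on_def strict_mono_def)
  have "gallai_ramsey n r (range p) (range p)" if "n \<ge> N" for n r
    unfolding gallai_ramsey_def
  proof
    fix col :: "(nat \<Rightarrow> real) \<Rightarrow> nat" assume "col \<in> topspace (Euclidean_space n) \<rightarrow> {1..r}"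
    have "\<forall>u w. (\<forall>p<k. u p = w p) \<longrightarrow> col (spread_point k a u) = col (spread_point k a w)"
    proof (intro allI impI)
      fix u w :: "nat \<Rightarrow> nat" assume "\<forall>p<k. u p = w p"
      then have "spread_point k a u = spread_point k a w"
        by (simp add: spread_point_def fun_eq_iff)
      then show "col (spread_point k a u) = col (spread_point k a w)" by simp
    qed
    from N[OF this] obtain g where g: "strict_mono_on {..<M} g" "g ` {..<M} \<subseteq> {..<N}"
      and or: "(\<exists>c. \<forall>i. col (spread_point k a (g \<circ> \<sigma> i)) = c) \<or> inj (\<lambda>i. col (spread_point k a (g \<circ> \<sigma> i)))"
      by blast
    define f where "f i = spread_point k a (g \<circ> \<sigma> i)" for i
    have bound: "(g \<circ> \<sigma> i) q < n" if "q < k" for i q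
    proof -
      have "g (\<sigma> i q) \<in> {..<N}" using g(2) M[OF that, of i] by blast
      then show ?thesis using \<open>n \<ge> N\<close> by simp
    qed
    have "edist n (f i) (f j) = dist (p i) (p j)" for i j
    proof -
      have "edist n (f i) (f j) = sqrt (spread_dist2 k a (g \<circ> \<sigma> i) (g \<circ> \<sigma> j))"
        unfolding f_def by (rule edist_spread_point) (rule bound, assumption)+
      also have "\<dots> = dist (p i) (p j)"
        unfolding dist using M strict_mono_on_imp_inj_on[OF g(1)]
        by (subst spread_dist2_relabel[of g "{..<M}"]) auto
      finally show ?thesis .
    qed
    moreover have "f i \<in> topspace (Euclidean_space n)" for i
      unfolding f_def using bound by (rule spread_point_in_Euclidean_space)
    moreover have "range f = (f \<circ> inv p) ` range p"
      using p(1) by (simp add: image_image)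
    ultimately have copy: "congruent_copy n (range p) (range f)"
      unfolding congruent_copy_def using p(1) by (intro exI[of _ "f \<circ> inv p"]) auto
    have "Defs.monochromatic col (range f) \<or> rainbow col (range f)"
      using or unfolding f_def[symmetric] Defs.monochromatic_def rainbow_def
      by (auto simp: inj_def inj_on_def)
    then show "(\<exists>T. congruent_copy n (range p) T \<and> Defs.monochromatic col T) \<or>
        (\<exists>T. congruent_copy n (range p) T \<and> rainbow col T)"
      using copy by blast
  qed
  then show ?thesis by blast
qed

theorem theorem1p6:
  fixes S :: "'a::euclidean_space set"
  assumes "tetrahedron S"
    and "\<exists>v\<in>S. \<exists>F. face S F \<and> height S v > circumradius F"
  shows "\<exists>n0::nat. \<forall>r\<ge>1. \<forall>n\<ge>n0. gallai_ramsey n r S S"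
proof -
  have card: "card S = 4" and ind: "\<not> affine_dependent S" using assms(1) by (auto simp: tetrahedron_def)
  then have "finite S" by (intro card_ge_0_finite) simp
  then obtain p :: "4 \<Rightarrow> 'a" where "bij_betw p UNIV S"
    using finite_same_card_bij[of "UNIV :: 4 set" S] card by auto
  then have "inj p" "range p = S" by (auto simp: bij_betw_def)
  then show ?thesis using simplex_gallai_ramsey[of p] ind by blast
qed

end
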